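(* Let $h \geq 2$ be an integer and set $n_1 = 2h(2h+1)$, $n_2 = (2h-1)(2h+1)$, $n_3 = 2h(2h+1)+(2h-1)$, $n_4 = (2h-1)2h$. Let $S = \langle n_1,n_2,n_3,n_4\rangle$ be the numerical semigroup generated by these integers. Then $k[[S]]$ does not have maximal reduced type and does not have minimal reduced type.
   Context: $\mathbb{N}$ denotes the non-negative integers. A numerical semigroup is a submonoid $S$ of $(\mathbb{N},+)$ with $\mathbb{N}\setminus S$ finite; $\langle n_1,\ldots,n_e\rangle$ is the submonoid of $\mathbb{N}$ generated by $n_1,\ldots,n_e$. The multiplicity $m(S)$ is the smallest nonzero element of $S$, and the Frobenius number $\mathrm{F}(S)$ is the largest integer not in $S$. A pseudo-Frobenius number of $S$ is an integer $f\notin S$ with $f+s\in S$ for all $s\in S\setminus\{0\}$; $\mathrm{PF}(S)$ is the set of these. Let $k$ be an algebraically closed field of characteristic zero. For $S$ with minimal generators $n_1,\ldots,n_e$, $R=k[[S]] := k[[t^{n_1},\ldots,t^{n_e}]]\subseteq k[[t]]$. The type, $\mathrm{type}(k[[S]])$, is the Cohen-Macaulay type of $k[[S]]$, which equals $|\mathrm{PF}(S)|$. With $K$ the quotient field of $R$, $\bar R$ its integral closure in $K$ and $\mathfrak{C}=(R:_K\bar R)$ the conductor ideal, the reduced type is $s(R)=\dim_k \frac{\mathfrak{C}+xR}{xR}$ with $x=t^{m(S)}$; it satisfies $1\le s(R)\le \mathrm{type}(R)$, and it is known to equal the number of integers in $[\mathrm{F}(S)-m(S)+1,\mathrm{F}(S)]\setminus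 S$. $R$ has maximal reduced type if $s(R)=\mathrm{type}(R)$, and minimal reduced type if $s(R)=1$. *)

theory Defs
  imports
    "HOL-Computational_Algebra.Computational_Algebra"
    "HOL-Library.Set_Algebras"
begin

section \<open>Numerical semigroups\<close>

inductive_set gen_semigroup :: "nat set \<Rightarrow> nat set" for N :: "nat set" where
  zero: "0 \<in> gen_semigroup N"
| gen: "n \<in> N \<Longrightarrow> n \<in> gen_semigroup N"
| add: "a \<in> gen_semigroup N \<Longrightarrow> b \<in> gen_semigroup N \<Longrightarrow> a + b \<in> gen_semigroup N"

definition numerical_semigroup :: "nat set \<Rightarrow> bool" where
  "numerical_semigroup S \<longleftrightarrow>
     0 \<in> S \<and> (\<forall>a\<in>S. \<forall>b\<in>S. a + b \<in> S) \<and> finite (- S)"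

definition multiplicity_of :: "nat set \<Rightarrow> nat" where
  "multiplicity_of S = (LEAST n. n \<in> S \<and> n \<noteq> 0)"

section \<open>Numerical semigroup rings\<close>

definition exponents :: "nat set \<Rightarrow> nat \<Rightarrow> (nat \<Rightarrow> nat) set" where
  "exponents N n = {a. (\<forall>i. i \<notin> N \<longrightarrow> a i = 0) \<and> (\<Sum>i\<in>N. a i * i) = n}"

text \<open>
  For a finite set \<open>N\<close> of positive integers this is \<open>k[[t^i : i \<in> N]]\<close>, i.e. the image of the
  formal power series ring in variables \<open>X_i\<close> (\<open>i \<in> N\<close>) under \<open>X_i \<mapsto> t^i\<close>: the series
  \<open>\<Sum>a. c a * X^a\<close> is sent to the series whose \<open>n\<close>-th coefficient is the (finite) sum of all
  \<open>c a\<close> with \<open>\<Sum>i. a i * i = n\<close>.  All rings here live inside the field \<open>k((t))\<close>.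
\<close>

definition power_series_subring :: "nat set \<Rightarrow> 'k::comm_ring_1 fls set" where
  "power_series_subring N =
     range (\<lambda>c. fps_to_fls (Abs_fps (\<lambda>n. \<Sum>a\<in>exponents N n. c a)))"

section \<open>Subrings of a field\<close>

text \<open>In this section \<open>R\<close> is a subring of the ambient field.\<close>

definition quotient_field :: "'a::field set \<Rightarrow> 'a set" where
  "quotient_field R = {a / b | a b. a \<in> R \<and> b \<in> R \<and> b \<noteq> 0}"

definition integral_closure :: "'a::field set \<Rightarrow> 'a set" where
  "integral_closure R = {z \<in> quotient_field R.
     \<exists>p. lead_coeff p = 1 \<and> (\<forall>i. coeff p i \<in> R) \<and> poly p z = 0}"

definition conductor :: "'a::field set \<Rightarrow> 'a set" where
  "conductor R = {z \<in> quotient_field R. \<forall>y\<in>integral_closure R. z * y \<in> R}"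

definition nonunits :: "'a::field set \<Rightarrow> 'a set" where
  "nonunits R = {a \<in> R. \<not> (\<exists>b\<in>R. a * b = 1)}"

text \<open>For local \<open>R\<close>, the preimage in \<open>R\<close> of the socle of \<open>R / xR\<close>.\<close>

definition socle_mod :: "'a::field set \<Rightarrow> 'a \<Rightarrow> 'a set" where
  "socle_mod R x = {r \<in> R. \<forall>y\<in>nonunits R. r * y \<in> x *o R}"

section \<open>Dimension of a quotient of subspaces of \<open>k((t))\<close>\<close>

text \<open>\<open>B\<close> is a finite set of representatives of a \<open>k\<close>-basis of \<open>V / W\<close> (for \<open>W \<subseteq> V\<close>).\<close>

definition basis_mod :: "'k::field fls set \<Rightarrow> 'k fls set \<Rightarrow> 'k fls set \<Rightarrow> bool" where
  "basis_mod V W B \<longleftrightarrow> finite B \<and> B \<subseteq> V \<and>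
     (\<forall>f\<in>V. \<exists>!c. (\<forall>b. b \<notin> B \<longrightarrow> c b = 0) \<and> f - (\<Sum>b\<in>B. fls_const (c b) * b) \<in> W)"

text \<open>Only meaningful if \<open>V / W\<close> is finite-dimensional.\<close>

definition quotient_dim :: "'k::field fls set \<Rightarrow> 'k fls set \<Rightarrow> nat" where
  "quotient_dim V W = (THE n. \<exists>B. basis_mod V W B \<and> card B = n)"

section \<open>Type and reduced type\<close>

text \<open>
  Here \<open>R\<close> is a one-dimensional Cohen-Macaulay local ring with residue field \<open>k \<subseteq> R\<close>, and \<open>x\<close> a
  parameter, i.e. a nonzero element of the maximal ideal.  The Cohen-Macaulay type of \<open>R\<close> is the
  dimension of the socle of \<open>R / xR\<close>; it does not depend on \<open>x\<close>.
\<close>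

definition cm_type :: "'k::field fls set \<Rightarrow> 'k fls \<Rightarrow> nat" where
  "cm_type R x = quotient_dim (socle_mod R x) (x *o R)"

definition reduced_type :: "'k::field fls set \<Rightarrow> 'k fls \<Rightarrow> nat" where
  "reduced_type R x = quotient_dim (conductor R + x *o R) (x *o R)"

definition maximal_reduced_type :: "'k::field fls set \<Rightarrow> 'k fls \<Rightarrow> bool" where
  "maximal_reduced_type R x \<longleftrightarrow> reduced_type R x = cm_type R x"

definition minimal_reduced_type :: "'k::field fls set \<Rightarrow> 'k fls \<Rightarrow> bool" where
  "minimal_reduced_type R x \<longleftrightarrow> reduced_type R x = 1"

section \<open>Well-definedness\<close>

lemma finite_exponents:
  assumes "finite N" "0 \<notin> N"
  shows "finite (exponents N n)"
proof (rule finite_subset)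
  show "exponents N n \<subseteq> {a. \<forall>i. (i \<in> N \<longrightarrow> a i \<in> {..n}) \<and> (i \<notin> N \<longrightarrow> a i = 0)}"
  proof (intro subsetI CollectI allI conjI impI)
    fix a i assume a: "a \<in> exponents N n" and i: "i \<in> N"
    have "i > 0" using i assms(2) by (cases i) auto
    have "a i \<le> a i * i" using \<open>i > 0\<close> by simp
    also have "\<dots> \<le> (\<Sum>i\<in>N. a i * i)" using assms(1) i by (intro member_le_sum) auto
    also have "\<dots> = n" using a by (simp add: exponents_def)
    finally show "a i \<in> {..n}" by simp
  qed (auto simp: exponents_def)
  show "finite {a. \<forall>i. (i \<in> N \<longrightarrow> a i \<in> {..n}) \<and> (i \<notin> N \<longrightarrow> a i = 0)}"
    using assms(1) by (intro finite_set_of_finite_funs) auto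
qed

lemma exponents_nonempty_iff:
  assumes "finite N"
  shows "exponents N n \<noteq> {} \<longleftrightarrow> n \<in> gen_semigroup N"
proof
  assume "n \<in> gen_semigroup N"
  then show "exponents N n \<noteq> {}"
  proof induction
    case zero
    have "(\<lambda>_. 0) \<in> exponents N 0" by (simp add: exponents_def)
    then show ?case by blast
  next
    case (gen n)
    have "(\<Sum>i\<in>N. (if i = n then 1 else 0) * i) = (\<Sum>i\<in>N. if i = n then n else 0)"
      by (rule sum.cong) auto
    then have "(\<lambda>i. if i = n then 1 else 0) \<in> exponents N n"
      using gen assms by (auto simp: exponents_def)
    then show ?case by blast
  next
    case (add m n)
    then obtain a b where "a \<in> exponents N m" "b \<in> exponents N n" by blast
    then have "(\<lambda>i. a i + b i) \<in> exponents N (m + n)"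
      by (auto simp: exponents_def add_mult_distrib sum.distrib)
    then show ?case by blast
  qed
next
  assume "exponents N n \<noteq> {}"
  then obtain a where a: "(\<Sum>i\<in>N. a i * i) = n" by (auto simp: exponents_def)
  have mult: "k * i \<in> gen_semigroup N" if "i \<in> N" for k i
    by (induction k) (simp_all add: gen_semigroup.zero gen_semigroup.add that gen_semigroup.gen)
  have "(\<Sum>i\<in>M. a i * i) \<in> gen_semigroup N" if "finite M" "M \<subseteq> N" for M
    using that by (induction M) (auto intro: gen_semigroup.intros mult)
  from this[OF assms order_refl] show "n \<in> gen_semigroup N" by (simp add: a)
qed

text \<open>In particular \<open>power_series_subring N\<close> depends only on the semigroup generated by \<open>N\<close>.\<close>

lemma power_series_subring_eq:
  assumes "finite N" "0 \<notin> N"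
  shows "power_series_subring N =
           fps_to_fls ` {f :: 'k::comm_ring_1 fps. \<forall>n. fps_nth f n \<noteq> 0 \<longrightarrow> n \<in> gen_semigroup N}"
proof (intro equalityI subsetI)
  fix z :: "'k fls"
  assume "z \<in> power_series_subring N"
  then obtain c where z: "z = fps_to_fls (Abs_fps (\<lambda>n. \<Sum>a\<in>exponents N n. c a))"
    by (auto simp: power_series_subring_def)
  have "n \<in> gen_semigroup N" if "(\<Sum>a\<in>exponents N n. c a) \<noteq> 0" for n
  proof -
    from that have "exponents N n \<noteq> {}" by auto
    then show ?thesis using exponents_nonempty_iff[OF assms(1)] by blast
  qed
  then show "z \<in> fps_to_fls ` {f. \<forall>n. fps_nth f n \<noteq> 0 \<longrightarrow> n \<in> gen_semigroup N}"
    by (simp add: z)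
next
  fix z :: "'k fls"
  assume "z \<in> fps_to_fls ` {f. \<forall>n. fps_nth f n \<noteq> 0 \<longrightarrow> n \<in> gen_semigroup N}"
  then obtain f where z: "z = fps_to_fls f"
    and f: "\<And>n. fps_nth f n \<noteq> 0 \<Longrightarrow> n \<in> gen_semigroup N" by blast
  define e where "e n = (SOME a. a \<in> exponents N n)" for n
  define c where "c a = (let n = \<Sum>i\<in>N. a i * i in if a = e n then fps_nth f n else 0)" for a
  have "(\<Sum>a\<in>exponents N n. c a) = fps_nth f n" for n
  proof -
    have "(\<Sum>a\<in>exponents N n. c a) = (\<Sum>a\<in>exponents N n. if a = e n then fps_nth f n else 0)"
      by (rule sum.cong) (auto simp: c_def exponents_def)
    also have "\<dots> = (if e n \<in> exponents N n then fps_nth f n else 0)"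
      using finite_exponents[OF assms] by simp
    also have "\<dots> = fps_nth f n"
    proof (cases "exponents N n = {}")
      case True
      then show ?thesis using f[of n] exponents_nonempty_iff[OF assms(1), of n] by auto
    next
      case False
      then have "e n \<in> exponents N n" unfolding e_def by (metis ex_in_conv someI_ex)
      then show ?thesis by simp
    qed
    finally show ?thesis .
  qed
  then have "z = fps_to_fls (Abs_fps (\<lambda>n. \<Sum>a\<in>exponents N n. c a))"
    by (simp add: z fps_eq_iff)
  then show "z \<in> power_series_subring N" unfolding power_series_subring_def by blast
qed

interpretation fls_vs: vector_space "\<lambda>c (f :: 'k::field fls). fls_const c * f"
  by standard (simp_all add: algebra_simps flip: fls_plus_const)

lemma ex1_unique: "\<exists>!c. P c \<Longrightarrow> P a \<Longrightarrow> P b \<Longrightarrow> a = b"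
  by blast

lemma card_basis_mod_le:
  assumes W: "fls_vs.subspace W" and B: "basis_mod V W B" and B': "basis_mod V W B'"
  shows "card B' \<le> card (B :: 'k::field fls set)"
proof -
  note [simp] = basis_mod_def
  have fin: "finite B" "finite B'" using B B' by auto
  have "\<exists>c. (\<forall>b. b \<notin> B \<longrightarrow> c b = 0) \<and> f - (\<Sum>b\<in>B. fls_const (c b) * b) \<in> W" if "f \<in> B'" for f
    using B B' that by (simp, blast)
  then obtain c where c: "\<And>f. f \<in> B' \<Longrightarrow> f - (\<Sum>b\<in>B. fls_const (c f b) * b) \<in> W" by metis
  define p where "p f = (\<Sum>b\<in>B. fls_const (c f b) * b)" for f
  have p: "f - p f \<in> W" if "f \<in> B'" for f using c[OF that] by (simp add: p_def)
  have key: "\<forall>f\<in>B'. d f = 0" if d: "(\<Sum>f\<in>B'. fls_const (d f) * p f) = 0" for d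
  proof (cases "B' = {}")
    case False
    then obtain g where g: "g \<in> B'" by blast
    define d' where "d' f = (if f \<in> B' then d f else 0)" for f
    have "(\<Sum>f\<in>B'. fls_const (d f) * (f - p f)) \<in> W"
      using p by (intro fls_vs.subspace_sum[OF W] fls_vs.subspace_scale[OF W]) auto
    then have dW: "(\<Sum>f\<in>B'. fls_const (d f) * f) \<in> W"
      using d by (simp add: right_diff_distrib sum_subtractf)
    from B' g have ex1: "\<exists>!c. (\<forall>b. b \<notin> B' \<longrightarrow> c b = 0) \<and>
        g - (\<Sum>b\<in>B'. fls_const (c b) * b) \<in> W" by (simp add: subset_iff)
    then obtain c0 where c0: "\<forall>b. b \<notin> B' \<longrightarrow> c0 b = 0" "g - (\<Sum>b\<in>B'. fls_const (c0 b) * b) \<in> W"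
      by blast
    have s: "(\<Sum>b\<in>B'. fls_const (d' b) * b) = (\<Sum>f\<in>B'. fls_const (d f) * f)"
      by (rule sum.cong) (auto simp: d'_def)
    have "(\<Sum>b\<in>B'. fls_const (c0 b + d' b) * b)
        = (\<Sum>b\<in>B'. fls_const (c0 b) * b) + (\<Sum>f\<in>B'. fls_const (d f) * f)"
      by (simp add: s sum.distrib distrib_right flip: fls_plus_const)
    then have "g - (\<Sum>b\<in>B'. fls_const (c0 b + d' b) * b) \<in> W"
      using fls_vs.subspace_diff[OF W c0(2) dW] by (simp add: algebra_simps)
    moreover have "\<forall>b. b \<notin> B' \<longrightarrow> c0 b + d' b = 0" using c0(1) by (simp add: d'_def)
    ultimately have "(\<lambda>b. c0 b + d' b) = c0"
      using c0 by (intro ex1_unique[OF ex1]) blast+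
    from fun_cong[OF this] have d0: "d' b = 0" for b by simp
    show ?thesis using d0 unfolding d'_def by (metis (full_types))
  qed simp
  have inj: "inj_on p B'"
  proof (rule inj_onI, rule ccontr)
    fix f g assume fg: "f \<in> B'" "g \<in> B'" "p f = p g" "f \<noteq> g"
    define d where "d b = (if b = f then 1 else if b = g then -1 else (0::'k))" for b
    have "(\<Sum>b\<in>B'. fls_const (d b) * p b) = (\<Sum>b\<in>{f,g}. fls_const (d b) * p b)"
      using fg fin by (intro sum.mono_neutral_right) (auto simp: d_def)
    also have "\<dots> = 0" using fg by (simp add: d_def flip: fls_const_uminus)
    finally have "d f = 0" using key fg by blast
    then show False by (simp add: d_def)
  qed
  have ind: "\<not> fls_vs.dependent (p ` B')"
  proof -
    have "\<forall>v\<in>p ` B'. u v = 0" if u: "(\<Sum>v\<in>p ` B'. fls_const (u v) * v) = 0" for u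
      using key[of "u \<circ> p"] u by (simp add: sum.reindex[OF inj])
    then show ?thesis using fls_vs.dependent_finite[of "p ` B'"] fin by auto
  qed
  have "p ` B' \<subseteq> fls_vs.span B"
    unfolding p_def
    by (intro image_subsetI fls_vs.span_sum fls_vs.span_scale fls_vs.span_base)
  from fls_vs.independent_span_bound[OF fin(1) ind this]
  show ?thesis by (simp add: card_image[OF inj])
qed

lemma quotient_dim_eq:
  assumes "fls_vs.subspace W" "basis_mod V W B"
  shows "quotient_dim V W = card B"
  unfolding quotient_dim_def
  using assms card_basis_mod_le[OF assms(1)] by (intro the_equality) (auto intro: le_antisym)

lemma numerical_semigroup_gen:
  assumes a: "a \<in> gen_semigroup N" and a1: "a + 1 \<in> gen_semigroup N"
  shows "numerical_semigroup (gen_semigroup N)"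
proof -
  have mult: "k * b \<in> gen_semigroup N" if "b \<in> gen_semigroup N" for k b
    by (induction k) (simp_all add: gen_semigroup.zero gen_semigroup.add that gen_semigroup.gen)
  have "n \<in> gen_semigroup N" if n: "n \<ge> a * a" for n
  proof (cases "a = 0")
    case True
    then show ?thesis using mult[OF a1, of n] by simp
  next
    case False
    then have "n mod a < a" by simp
    moreover have "a \<le> n div a" using n False by (simp add: less_eq_div_iff_mult_less_eq)
    ultimately have r: "n mod a \<le> n div a" by simp
    have "n = (n div a - n mod a) * a + n mod a * (a + 1)"
    proof -
      have "n = n div a * a + n mod a" by simp
      also have "n div a = (n div a - n mod a) + n mod a" using r by simp
      finally show ?thesis by (simp only: algebra_simps)
    qed
    then show ?thesis by (metis gen_semigroup.add mult a a1)
  qed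
  then have "- gen_semigroup N \<subseteq> {..<a * a}" by (meson ComplD lessThan_iff not_le subsetI)
  then show ?thesis unfolding numerical_semigroup_def
    by (auto intro: gen_semigroup.intros finite_subset)
qed

lemma numerical_semigroup_four_generated:
  fixes h :: nat
  assumes "h \<ge> 2"
  shows "numerical_semigroup (gen_semigroup
    {2*h*(2*h+1), (2*h-1)*(2*h+1), 2*h*(2*h+1) + (2*h-1), (2*h-1)*(2*h)})"
    (is "numerical_semigroup (gen_semigroup ?N)")
proof -
  have mult: "k * n \<in> gen_semigroup ?N" if "n \<in> ?N" for k n
    by (induction k) (simp_all only: mult_0 mult_Suc gen_semigroup.zero gen_semigroup.add gen_semigroup.gen that)
  obtain j where j: "h = Suc j" using assms by (cases h) auto
  have "(2*h-1) * (2*h*(2*h+1)) + 1 =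
      h * (2*h*(2*h+1) + (2*h-1)) + (h-1) * ((2*h-1)*(2*h+1))"
    by (simp add: j algebra_simps)
  also have "\<dots> \<in> gen_semigroup ?N" by (intro gen_semigroup.add mult) auto
  finally show ?thesis by (intro numerical_semigroup_gen[OF mult]) auto
qed

end

theory Submission
  imports Defs
begin

text \<open>
  Put \<open>q = 2 h\<close>, \<open>M = n\<^sub>4 = q (q - 1)\<close>, \<open>a = q - 1\<close> and \<open>b = 2 q\<close>.  The generators are
  \<open>n\<^sub>4 = M\<close>, \<open>n\<^sub>2 = M + a\<close>, \<open>n\<^sub>1 = M + b\<close> and \<open>n\<^sub>3 = M + a + b\<close>, that is, the corners of a
  parallelogram.  Hence \<open>S\<close> consists of the numbers \<open>k M + u a + v b\<close> with \<open>0 \<le> u, v \<le> k\<close>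
  (\<open>gen_semigroup_parallelogram\<close>).  As \<open>q\<close> and \<open>q - 1\<close> are coprime and \<open>q - 1\<close> is odd, every
  integer can be written as \<open>k M + u a + v b\<close> with \<open>0 \<le> u < q\<close> and \<open>0 \<le> v < q - 1\<close>
  (\<open>canonical_form_exists\<close>).  Enlarging \<open>u\<close> by \<open>q\<close> or \<open>v\<close> by \<open>q - 1\<close> costs one, respectively
  two, copies of \<open>M\<close>, so that among all representations with \<open>u, v \<ge> 0\<close> the canonical one has
  the largest \<open>k\<close> (\<open>canonical_form_minimal\<close>).  Therefore the integer lies in \<open>S\<close> if and only if
  its canonical form satisfies \<open>max u v \<le> k\<close>.

  So all \<open>(k, u, v) = (q - 2, q - 1, v)\<close> give gaps, and these decide the theorem.  For
  \<open>v = q - 2\<close> the gap is the Frobenius number \<open>F\<close>.  For \<open>v = q - 3\<close> it is the gap \<open>F - 2 q\<close>,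
  and \<open>2 q < M\<close>; thus the interval \<open>[F - M + 1, F]\<close> contains two gaps and the reduced type is
  at least \<open>2\<close>.  For \<open>v = 0\<close> it is a pseudo-Frobenius number which is at most \<open>F - M\<close>.  All gaps
  in the interval are pseudo-Frobenius numbers, because a nonzero element of \<open>S\<close> is at least
  \<open>M\<close>; hence there are strictly fewer of them than there are pseudo-Frobenius numbers.

  It remains to identify the two invariants of the ring with these two numbers.  The ring, its
  normalization \<open>k[[t]]\<close>, the conductor, the maximal ideal, the socle modulo \<open>x\<close> and \<open>x R\<close> all
  turn out to be the set of \<^emph>\<open>all\<close> Laurent series with support in some set of integers.  A
  quotient of two such spaces has the monomials with exponent in the difference of the supports
  as a basis (\<open>quotient_dim_supported_on\<close>), so each dimension is the size of a set of integers
  (\<open>cm_type_supported_on\<close>, \<open>reduced_type_supported_on\<close>).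
\<close>

unbundle fps_syntax

section \<open>Subspaces of Laurent series with prescribed support\<close>

definition supported_on :: "int set \<Rightarrow> 'k::zero fls set" where
  "supported_on A = {f. \<forall>n. f $$ n \<noteq> 0 \<longrightarrow> n \<in> A}"

lemma supported_onI: "(\<And>n. f $$ n \<noteq> 0 \<Longrightarrow> n \<in> A) \<Longrightarrow> f \<in> supported_on A"
  by (simp add: supported_on_def)

lemma supported_onD: "f \<in> supported_on A \<Longrightarrow> f $$ n \<noteq> 0 \<Longrightarrow> n \<in> A"
  by (simp add: supported_on_def)

lemma supported_on_mono: "f \<in> supported_on A \<Longrightarrow> A \<subseteq> B \<Longrightarrow> f \<in> supported_on B"
  by (auto simp: supported_on_def)

lemma subspace_supported_on: "fls_vs.subspace (supported_on A :: 'k::field fls set)"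
  unfolding fls_vs.subspace_def
proof (intro conjI ballI allI)
  fix f g :: "'k fls" assume fg: "f \<in> supported_on A" "g \<in> supported_on A"
  show "f + g \<in> supported_on A"
  proof (rule supported_onI)
    fix n assume "(f + g) $$ n \<noteq> 0"
    then have "f $$ n \<noteq> 0 \<or> g $$ n \<noteq> 0" by auto
    then show "n \<in> A" using fg supported_onD by blast
  qed
qed (auto simp: supported_on_def)

lemma supported_on_mult:
  fixes f g :: "'k::field fls"
  assumes "f \<in> supported_on A" "g \<in> supported_on B"
    and "\<And>a b. a \<in> A \<Longrightarrow> b \<in> B \<Longrightarrow> a + b \<in> C"
  shows "f * g \<in> supported_on C"
proof (rule supported_onI)
  fix n assume "(f * g) $$ n \<noteq> 0"
  then obtain i where "f $$ i * g $$ (n - i) \<noteq> 0"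
    unfolding fls_times_nth(2) by (meson sum.not_neutral_contains_not_neutral)
  then have "i \<in> A" "n - i \<in> B" using assms(1,2) by (auto dest: supported_onD)
  from assms(3)[OF this] show "n \<in> C" by simp
qed

lemma supported_on_positive_power:
  fixes f :: "'k::field fls"
  assumes "f \<in> supported_on {1..}"
  shows "f ^ n \<in> supported_on {int n..}"
proof (induction n)
  case 0
  then show ?case by (auto intro: supported_onI split: if_splits)
next
  case (Suc n)
  then show ?case using supported_on_mult[OF assms Suc, of "{int (Suc n)..}"] by simp
qed

lemma supported_on_nonneg_iff:
  "f \<in> supported_on {0..} \<longleftrightarrow> fls_subdegree (f :: 'k::field fls) \<ge> 0"
  by (cases "f = 0")
    (auto simp: supported_on_def intro: fls_subdegree_geI order_trans[OF _ fls_subdegree_leI])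

lemma monomial_in_supported_on:
  "n \<in> A \<Longrightarrow> (fls_X_intpow n :: 'k::field fls) \<in> supported_on A"
  by (auto intro: supported_onI split: if_splits)

lemma monomial_mult_nth:
  "((fls_X_intpow i :: 'k::field fls) * f) $$ n = f $$ (n - i)"
  by (simp add: fls_X_intpow_times_conv_shift)

lemma monomial_translate_supported_on:
  "fls_X ^ m *o (supported_on A :: 'k::field fls set) = supported_on {n. n - int m \<in> A}"
proof (intro equalityI subsetI)
  fix f :: "'k fls" assume "f \<in> fls_X ^ m *o supported_on A"
  then show "f \<in> supported_on {n. n - int m \<in> A}"
    by (auto simp: elt_set_times_def supported_on_def fls_X_power_times_conv_shift)
next
  fix f :: "'k fls" assume f: "f \<in> supported_on {n. n - int m \<in> A}"
  have "f = fls_X ^ m * fls_shift (int m) f"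
    by (simp add: fls_X_power_times_conv_shift)
  moreover have "fls_shift (int m) f \<in> supported_on A"
  proof (rule supported_onI)
    fix n assume "fls_shift (int m) f $$ n \<noteq> 0"
    then have "f $$ (n + int m) \<noteq> 0" by simp
    from supported_onD[OF f this] show "n \<in> A" by simp
  qed
  ultimately show "f \<in> fls_X ^ m *o supported_on A"
    unfolding elt_set_times_def by blast
qed

lemma supported_on_plus:
  "(supported_on A :: 'k::field fls set) + supported_on B = supported_on (A \<union> B)"
proof (intro equalityI subsetI)
  fix f :: "'k fls" assume "f \<in> supported_on A + supported_on B"
  then obtain g h where gh: "f = g + h" "g \<in> supported_on A" "h \<in> supported_on B"
    by (auto elim: set_plus_elim)
  then have "g \<in> supported_on (A \<union> B)" "h \<in> supported_on (A \<union> B)"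
    by (auto intro: supported_on_mono)
  then show "f \<in> supported_on (A \<union> B)"
    using fls_vs.subspace_add[OF subspace_supported_on] gh(1) by blast
next
  fix f :: "'k fls" assume f: "f \<in> supported_on (A \<union> B)"
  define g where "g = Abs_fls (\<lambda>n. if n \<in> A then f $$ n else 0)"
  have g: "g $$ n = (if n \<in> A then f $$ n else 0)" for n
    unfolding g_def by (rule nth_Abs_fls_lower_bound[of "fls_subdegree f"]) auto
  have "g \<in> supported_on A" "f - g \<in> supported_on B"
    using f by (auto simp: supported_on_def g split: if_splits)
  then have "g + (f - g) \<in> supported_on A + supported_on B" by (rule set_plus_intro)
  then show "f \<in> supported_on A + supported_on B" by simp
qed

text \<open>
  A series supported on \<open>A\<close> is congruent, modulo the series supported on \<open>B\<close>, to the sum of its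
  finitely many terms with exponent in \<open>A - B\<close>, and these terms are determined by the class.
\<close>

lemma quotient_dim_supported_on:
  assumes BA: "B \<subseteq> A" and fin: "finite (A - B)"
  shows "quotient_dim (supported_on A :: 'k::field fls set) (supported_on B) = card (A - B)"
proof -
  define t :: "int \<Rightarrow> 'k fls" where "t n = fls_X_intpow n" for n
  have t_nth: "t n $$ i = (if i = n then 1 else 0)" for n i by (simp add: t_def)
  have inj: "inj t" by (metis injI t_nth zero_neq_one)
  have sum_nth: "(\<Sum>b\<in>t ` (A - B). fls_const (c b) * b) $$ n
      = (if n \<in> A - B then c (t n) else 0)" for c :: "'k fls \<Rightarrow> 'k" and n
  proof -
    have "(\<Sum>b\<in>t ` (A - B). fls_const (c b) * b) = (\<Sum>i\<in>A - B. fls_const (c (t i)) * t i)"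
      by (simp add: sum.reindex inj_on_subset[OF inj])
    also have "\<dots> $$ n = (\<Sum>i\<in>A - B. if n = i then c (t i) else 0)"
      unfolding fls_nth_sum by (rule sum.cong) (auto simp: t_nth)
    finally show ?thesis using fin by simp
  qed
  have cong_iff: "f - (\<Sum>b\<in>t ` (A - B). fls_const (c b) * b) \<in> supported_on B \<longleftrightarrow>
      (\<forall>n\<in>A - B. c (t n) = f $$ n)" if f: "f \<in> supported_on A" for f c
  proof
    assume "f - (\<Sum>b\<in>t ` (A - B). fls_const (c b) * b) \<in> supported_on B"
    then show "\<forall>n\<in>A - B. c (t n) = f $$ n"
      by (force simp: supported_on_def sum_nth)
  next
    assume c: "\<forall>n\<in>A - B. c (t n) = f $$ n"
    show "f - (\<Sum>b\<in>t ` (A - B). fls_const (c b) * b) \<in> supported_on B"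
      using c f by (auto simp: supported_on_def sum_nth split: if_splits)
  qed
  have "basis_mod (supported_on A) (supported_on B) (t ` (A - B))"
    unfolding basis_mod_def
  proof (intro conjI ballI)
    show "finite (t ` (A - B))" using fin by simp
    show "t ` (A - B) \<subseteq> supported_on A"
      unfolding t_def by (auto intro!: monomial_in_supported_on)
    fix f :: "'k fls" assume f: "f \<in> supported_on A"
    \<comment> \<open>the exponent of a monomial is recovered as its subdegree\<close>
    define c where "c b = (if b \<in> t ` (A - B) then f $$ (fls_subdegree b) else 0)" for b
    show "\<exists>!c. (\<forall>b. b \<notin> t ` (A - B) \<longrightarrow> c b = 0) \<and>
        f - (\<Sum>b\<in>t ` (A - B). fls_const (c b) * b) \<in> supported_on B"
      unfolding cong_iff[OF f]
    proof (rule ex1I[of _ c])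
      show "(\<forall>b. b \<notin> t ` (A - B) \<longrightarrow> c b = 0) \<and> (\<forall>n\<in>A - B. c (t n) = f $$ n)"
        by (auto simp: c_def) (simp add: t_def)
      fix d assume d: "(\<forall>b. b \<notin> t ` (A - B) \<longrightarrow> d b = 0) \<and> (\<forall>n\<in>A - B. d (t n) = f $$ n)"
      show "d = c"
      proof
        fix b show "d b = c b"
          using d by (cases "b \<in> t ` (A - B)") (auto simp: c_def, simp add: t_def)
      qed
    qed
  qed
  from quotient_dim_eq[OF subspace_supported_on this]
  show ?thesis by (simp add: card_image inj_on_subset[OF inj])
qed

section \<open>The ring of series supported on a numerical semigroup\<close>

text \<open>
  The set of elements of a numerical semigroup, its Frobenius number and its multiplicity.  They
  are taken inside \<open>int\<close> because exponents of Laurent series and pseudo-Frobenius numbers may be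
  negative: the semigroup of all natural numbers has \<open>F = -1\<close>.
\<close>

locale semigroup_exponents =
  fixes T :: "int set" and F :: int and m :: nat
  assumes zero_mem: "0 \<in> T"
    and add_mem: "a \<in> T \<Longrightarrow> b \<in> T \<Longrightarrow> a + b \<in> T"
    and nonneg: "a \<in> T \<Longrightarrow> a \<ge> 0"
    and frobenius_not_mem: "F \<notin> T"
    and above_frobenius: "n > F \<Longrightarrow> n \<in> T"
    and mult_mem: "int m \<in> T"
    and mult_pos: "m > 0"
    and mult_le: "a \<in> T \<Longrightarrow> a \<noteq> 0 \<Longrightarrow> int m \<le> a"
begin

definition pseudo_frobenius :: "int set" where
  "pseudo_frobenius = {f. f \<notin> T \<and> (\<forall>s\<in>T - {0}. f + s \<in> T)}"

definition high_gaps :: "int set" where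
  "high_gaps = {g. g \<notin> T \<and> F - int m < g}"

lemma supported_on_T_mult:
  "f \<in> supported_on T \<Longrightarrow> g \<in> supported_on T \<Longrightarrow> f * g \<in> (supported_on T :: 'k::field fls set)"
  using supported_on_mult add_mem by blast

lemma const_in_supported_on_T: "fls_const c \<in> (supported_on T :: 'k::field fls set)"
  by (auto intro: supported_onI simp: zero_mem split: if_splits)

text \<open>
  Multiplication by a high power of \<open>t\<close> moves any Laurent series, and \<open>1\<close> as well, beyond the
  Frobenius number.
\<close>

lemma quotient_field_supported_on: "quotient_field (supported_on T :: 'k::field fls set) = UNIV"
proof (intro equalityI subsetI UNIV_I)
  fix z :: "'k fls"
  define N where "N = max (F + 1) (F + 1 - fls_subdegree z)"
  have N: "N > F" "N + fls_subdegree z > F" by (simp_all add: N_def)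
  have "fls_X_intpow N * z \<in> supported_on T"
  proof (rule supported_onI)
    fix n assume "(fls_X_intpow N * z) $$ n \<noteq> 0"
    then have "z $$ (n - N) \<noteq> 0" by (simp only: monomial_mult_nth not_False_eq_True)
    then have "fls_subdegree z \<le> n - N" by (rule fls_subdegree_leI)
    then show "n \<in> T" using N by (intro above_frobenius) simp
  qed
  moreover have "(fls_X_intpow N :: 'k fls) \<in> supported_on T"
    by (intro monomial_in_supported_on above_frobenius N)
  moreover have "z = (fls_X_intpow N * z) / fls_X_intpow N"
    by (rule nonzero_mult_div_cancel_left[symmetric]) (rule fls_X_intpow_nonzero)
  ultimately show "z \<in> quotient_field (supported_on T)"
    unfolding quotient_field_def using fls_X_intpow_nonzero by blast
qed

lemma coeff_linear_power_in_supported_on_T: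
  assumes "a \<in> supported_on T"
  shows "coeff ([:a, 1:] ^ n) i \<in> (supported_on T :: 'k::field fls set)"
proof (induction n arbitrary: i)
  case 0
  then show ?case
    using const_in_supported_on_T[of 1] const_in_supported_on_T[of 0] by (cases i) auto
next
  case (Suc n)
  have "coeff ([:a, 1:] ^ Suc n) i
      = a * coeff ([:a, 1:] ^ n) i + (case i of 0 \<Rightarrow> 0 | Suc j \<Rightarrow> coeff ([:a, 1:] ^ n) j)"
    by (simp add: coeff_pCons)
  also have "\<dots> \<in> supported_on T"
    using const_in_supported_on_T[of 0] Suc
    by (intro fls_vs.subspace_add[OF subspace_supported_on] supported_on_T_mult assms)
      (auto split: nat.split)
  finally show ?case .
qed

text \<open>
  A power series \<open>z\<close> with constant term \<open>c\<close> is a root of the monic polynomial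
  \<open>(X - c)^N - (z - c)^N\<close>; for \<open>N > F\<close> its coefficients lie in the ring, since \<open>(z - c)^N\<close> has
  order at least \<open>N\<close>.  Conversely, if \<open>z\<close> has a pole, then dividing a monic equation of degree
  \<open>d\<close> by \<open>z^d\<close> expresses \<open>-1\<close> as a sum of series without constant term.
\<close>

lemma integral_closure_supported_on:
  "integral_closure (supported_on T :: 'k::field fls set) = supported_on {0..}"
proof (intro equalityI subsetI)
  fix z :: "'k fls" assume z: "z \<in> supported_on {0..}"
  define N where "N = Suc (nat F)"
  have N: "int N > F" "N > 0" by (simp_all add: N_def)
  define c y where "c = fls_const (z $$ 0)" and "y = z - c"
  have "y \<in> supported_on {1..}"
  proof (rule supported_onI)
    fix n assume "y $$ n \<noteq> 0"
    then have "n \<noteq> 0" "z $$ n \<noteq> 0" by (auto simp: y_def c_def split: if_splits)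
    with supported_onD[OF z, of n] show "n \<in> {1..}" by simp
  qed
  then have "y ^ N \<in> supported_on {int N..}" by (rule supported_on_positive_power)
  then have yN: "- (y ^ N) \<in> supported_on T"
    using N above_frobenius by (auto intro!: supported_on_mono[of _ "{int N..}"] simp: supported_on_def)
  define p where "p = [:- (y ^ N):] + [:- c, 1:] ^ N"
  have "lead_coeff p = lead_coeff ([:- c, 1:] ^ N)"
    unfolding p_def using N by (intro lead_coeff_add_le) (simp add: degree_linear_power)
  also have "\<dots> = 1" by (simp add: lead_coeff_power)
  finally have "lead_coeff p = 1" .
  moreover have "coeff p i \<in> supported_on T" for i
  proof -
    have "coeff [:- (y ^ N):] i \<in> supported_on T"
      using yN const_in_supported_on_T[of 0] by (auto simp: coeff_pCons split: nat.split)
    moreover have "- c \<in> supported_on T"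
      using const_in_supported_on_T[of "- (z $$ 0)"] by (simp add: c_def)
    ultimately show ?thesis unfolding p_def coeff_add
      by (intro fls_vs.subspace_add[OF subspace_supported_on] coeff_linear_power_in_supported_on_T)
  qed
  moreover have "poly p z = 0" by (simp add: p_def y_def poly_power)
  ultimately show "z \<in> integral_closure (supported_on T)"
    unfolding integral_closure_def quotient_field_supported_on by blast
next
  fix z :: "'k fls" assume "z \<in> integral_closure (supported_on T)"
  then obtain p where monic: "lead_coeff p = 1" and p: "\<And>i. coeff p i \<in> supported_on T"
    and root: "poly p z = 0" by (auto simp: integral_closure_def)
  show "z \<in> supported_on {0..}"
  proof (rule ccontr)
    assume "z \<notin> supported_on {0..}"
    then have deg: "fls_subdegree z < 0" by (simp add: supported_on_nonneg_iff)
    then have z0: "z \<noteq> 0" by auto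
    define w where "w = inverse z"
    have "fls_subdegree w > 0" using deg by (simp add: w_def fls_inverse_subdegree)
    then have w: "w \<in> supported_on {1..}"
      by (auto intro!: supported_onI dest!: fls_subdegree_leI)
    let ?d = "degree p"
    have "0 = poly p z * w ^ ?d" by (simp add: root)
    also have "\<dots> = (\<Sum>i\<le>?d. coeff p i * w ^ (?d - i))"
      unfolding poly_altdef sum_distrib_right
    proof (rule sum.cong)
      fix i assume "i \<in> {..?d}"
      then have "w ^ ?d = w ^ i * w ^ (?d - i)" by (simp flip: power_add)
      then show "coeff p i * z ^ i * w ^ ?d = coeff p i * w ^ (?d - i)"
        using z0 by (simp add: w_def power_inverse)
    qed simp
    also have "\<dots> = 1 + (\<Sum>i<?d. coeff p i * w ^ (?d - i))"
      using monic by (simp add: lessThan_Suc_atMost[symmetric])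
    finally have eq: "1 + (\<Sum>i<?d. coeff p i * w ^ (?d - i)) = 0" by simp
    have "(\<Sum>i<?d. coeff p i * w ^ (?d - i)) \<in> supported_on {1..}"
    proof (intro fls_vs.subspace_sum[OF subspace_supported_on])
      fix i assume i: "i \<in> {..<?d}"
      show "coeff p i * w ^ (?d - i) \<in> supported_on {1..}"
        using i nonneg
        by (intro supported_on_mult[OF p supported_on_positive_power[OF w]]) fastforce
    qed
    then have "(\<Sum>i<?d. coeff p i * w ^ (?d - i)) $$ 0 = 0"
      by (auto dest: supported_onD)
    with arg_cong[OF eq, of "\<lambda>f. f $$ 0"] show False by simp
  qed
qed

text \<open>
  If \<open>z\<close> had a nonzero coefficient at some \<open>n \<le> F\<close>, the integral element \<open>t^(F - n)\<close> would carry
  it to the exponent \<open>F\<close>, which is not in \<open>T\<close>.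
\<close>

lemma conductor_supported_on:
  "conductor (supported_on T :: 'k::field fls set) = supported_on {F<..}"
proof (intro equalityI subsetI)
  fix z :: "'k fls" assume z: "z \<in> conductor (supported_on T)"
  show "z \<in> supported_on {F<..}"
  proof (rule supported_onI)
    fix n assume n: "z $$ n \<noteq> 0"
    show "n \<in> {F<..}"
    proof (rule ccontr)
      assume "n \<notin> {F<..}"
      then have "(fls_X_intpow (F - n) :: 'k fls) \<in> integral_closure (supported_on T)"
        unfolding integral_closure_supported_on by (intro monomial_in_supported_on) simp
      then have "z * fls_X_intpow (F - n) \<in> supported_on T"
        using z unfolding conductor_def by blast
      then have "fls_X_intpow (F - n) * z \<in> supported_on T" by (simp only: mult.commute)
      moreover have "(fls_X_intpow (F - n) * z) $$ F \<noteq> 0" unfolding monomial_mult_nth using n by simp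
      ultimately show False using frobenius_not_mem supported_onD by blast
    qed
  qed
next
  fix z :: "'k fls" assume "z \<in> supported_on {F<..}"
  then have "z * y \<in> supported_on T" if "y \<in> supported_on {0..}" for y
    using that by (rule supported_on_mult) (simp add: above_frobenius)
  then show "z \<in> conductor (supported_on T)"
    by (simp add: conductor_def integral_closure_supported_on quotient_field_supported_on)
qed

text \<open>
  Comparing coefficients in \<open>inverse a * a = 1\<close> expresses the \<open>n\<close>-th coefficient of the inverse
  by products of an earlier coefficient of it, at \<open>i\<close>, and the coefficient of \<open>a\<close> at \<open>n - i\<close>.  By
  induction both exponents lie in \<open>T\<close> if the product is nonzero.  Consequently the ring is local,
  and its nonunits are the series without constant term.
\<close>

lemma inverse_in_supported_on_T:
  assumes a: "a \<in> supported_on T" and a0: "(a :: 'k::field fls) $$ 0 \<noteq> 0"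
  shows "inverse a \<in> supported_on T"
proof (rule supported_onI)
  have "fls_subdegree a \<ge> 0"
    using supported_on_mono[OF a, of "{0..}"] nonneg by (auto simp: supported_on_nonneg_iff)
  moreover have "fls_subdegree a \<le> 0" using a0 by (rule fls_subdegree_leI)
  ultimately have sa: "fls_subdegree a = 0" by simp
  then have sb: "fls_subdegree (inverse a) = 0" by (simp add: fls_inverse_subdegree)
  have a_nz: "a \<noteq> 0" using a0 by auto
  fix n assume "inverse a $$ n \<noteq> 0"
  moreover from this have "n \<ge> 0" using sb fls_subdegree_leI by metis
  ultimately show "n \<in> T"
  proof (induction "nat n" arbitrary: n rule: less_induct)
    case less
    show ?case
    proof (cases "n = 0")
      case False
      with less.prems have n: "n > 0" by simp
      have "0 = (inverse a * a) $$ n" using a_nz n by simp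
      also have "\<dots> = (\<Sum>i=0..n. inverse a $$ i * a $$ (n - i))"
        unfolding fls_times_nth(2) by (simp add: sa sb)
      also have "{0..n} = insert n {0..<n}" using n by auto
      finally have "(\<Sum>i\<in>{0..<n}. inverse a $$ i * a $$ (n - i)) \<noteq> 0"
        using less.prems a0 by (auto simp: add_eq_0_iff)
      then obtain i where i: "i \<in> {0..<n}" "inverse a $$ i * a $$ (n - i) \<noteq> 0"
        by (meson sum.not_neutral_contains_not_neutral)
      then have "i \<in> T" by (intro less.hyps) auto
      moreover have "n - i \<in> T" using i a by (auto dest: supported_onD)
      ultimately show ?thesis using add_mem by fastforce
    qed (simp add: zero_mem)
  qed
qed

lemma nonunits_supported_on:
  "nonunits (supported_on T :: 'k::field fls set) = supported_on (T - {0})"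
proof (intro equalityI subsetI)
  fix a :: "'k fls" assume a: "a \<in> nonunits (supported_on T)"
  then have aT: "a \<in> supported_on T" by (simp add: nonunits_def)
  have "a $$ 0 = 0"
  proof (rule ccontr)
    assume a0: "a $$ 0 \<noteq> 0"
    then have "a * inverse a = 1" by (intro right_inverse) auto
    with inverse_in_supported_on_T[OF aT a0] a show False by (auto simp: nonunits_def)
  qed
  then show "a \<in> supported_on (T - {0})" using aT by (auto simp: supported_on_def)
next
  fix a :: "'k fls" assume a: "a \<in> supported_on (T - {0})"
  have "a * b \<noteq> 1" if b: "b \<in> supported_on T" for b
  proof
    assume "a * b = 1"
    moreover have "a * b \<in> supported_on {1..}"
      using a b by (rule supported_on_mult) (force dest: nonneg)
    ultimately show False by (auto dest: supported_onD[of _ _ 0])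
  qed
  then show "a \<in> nonunits (supported_on T)"
    using supported_on_mono[OF a, of T] by (auto simp: nonunits_def)
qed

text \<open>
  Testing with the monomials \<open>t^s\<close>, \<open>s \<in> T - {0}\<close>, suffices, because membership in \<open>x R\<close> is a
  condition on the support.
\<close>

lemma socle_mod_supported_on:
  "socle_mod (supported_on T :: 'k::field fls set) (fls_X ^ m)
     = supported_on {r \<in> T. \<forall>s\<in>T - {0}. r + s - int m \<in> T}"
  (is "_ = supported_on ?A")
proof (intro equalityI subsetI)
  fix r :: "'k fls" assume "r \<in> socle_mod (supported_on T) (fls_X ^ m)"
  then have rT: "r \<in> supported_on T"
    and r: "\<And>y. y \<in> supported_on (T - {0}) \<Longrightarrow> r * y \<in> supported_on {n. n - int m \<in> T}"
    by (auto simp: socle_mod_def nonunits_supported_on monomial_translate_supported_on)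
  show "r \<in> supported_on ?A"
  proof (rule supported_onI)
    fix n assume n: "r $$ n \<noteq> 0"
    have "n + s - int m \<in> T" if s: "s \<in> T - {0}" for s
    proof -
      have "fls_X_intpow s * r \<in> supported_on {n. n - int m \<in> T}"
        using r[OF monomial_in_supported_on[OF s]] by (simp only: mult.commute)
      moreover have "(fls_X_intpow s * r) $$ (n + s) \<noteq> 0"
        unfolding monomial_mult_nth using n by simp
      ultimately show ?thesis using supported_onD by blast
    qed
    then show "n \<in> ?A" using supported_onD[OF rT n] by blast
  qed
next
  fix r :: "'k fls" assume r: "r \<in> supported_on ?A"
  have "r * y \<in> supported_on {n. n - int m \<in> T}" if "y \<in> supported_on (T - {0})" for y
    using r that by (rule supported_on_mult) auto
  moreover have "r \<in> supported_on T" using r by (rule supported_on_mono) auto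
  ultimately show "r \<in> socle_mod (supported_on T) (fls_X ^ m)"
    by (simp add: socle_mod_def nonunits_supported_on monomial_translate_supported_on)
qed

lemma finite_pseudo_frobenius: "finite pseudo_frobenius"
proof (rule finite_subset)
  show "pseudo_frobenius \<subseteq> {- int m..F}"
  proof
    fix f assume f: "f \<in> pseudo_frobenius"
    then have "f + int m \<in> T" using mult_mem mult_pos by (auto simp: pseudo_frobenius_def)
    moreover have "f \<le> F" using f above_frobenius by (force simp: pseudo_frobenius_def)
    ultimately show "f \<in> {- int m..F}" using nonneg by fastforce
  qed
qed simp

text \<open>
  Adding a nonzero element of the semigroup, which is at least the multiplicity, takes such a gap
  beyond \<open>F\<close>.
\<close>

lemma high_gaps_subset: "high_gaps \<subseteq> pseudo_frobenius"
proof
  fix g assume g: "g \<in> high_gaps"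
  have "g + s \<in> T" if "s \<in> T - {0}" for s
    using g that mult_le[of s] by (intro above_frobenius) (simp add: high_gaps_def)
  then show "g \<in> pseudo_frobenius" using g by (simp add: high_gaps_def pseudo_frobenius_def)
qed

text \<open>
  In the socle, modulo the exponents \<open>m + T\<close> of \<open>x R\<close>, exactly the exponents \<open>m + f\<close> with \<open>f\<close>
  pseudo-Frobenius remain.
\<close>

lemma cm_type_supported_on:
  "cm_type (supported_on T :: 'k::field fls set) (fls_X ^ m) = card pseudo_frobenius"
proof -
  let ?A = "{r \<in> T. \<forall>s\<in>T - {0}. r + s - int m \<in> T}" and ?B = "{n. n - int m \<in> T}"
  have sub: "?B \<subseteq> ?A"
  proof
    fix n assume n: "n \<in> ?B"
    then have "n \<in> T" using add_mem[OF _ mult_mem, of "n - int m"] by simp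
    moreover have "n + s - int m \<in> T" if "s \<in> T" for s
      using add_mem[of "n - int m" s] n that by (simp add: algebra_simps)
    ultimately show "n \<in> ?A" by blast
  qed
  have diff: "?A - ?B = (\<lambda>f. f + int m) ` pseudo_frobenius"
  proof (intro equalityI subsetI)
    fix n assume "n \<in> ?A - ?B"
    then have "n - int m \<in> pseudo_frobenius" by (auto simp: pseudo_frobenius_def algebra_simps)
    then show "n \<in> (\<lambda>f. f + int m) ` pseudo_frobenius" by (intro image_eqI) auto
  next
    fix n assume "n \<in> (\<lambda>f. f + int m) ` pseudo_frobenius"
    then show "n \<in> ?A - ?B" using mult_mem mult_pos by (auto simp: pseudo_frobenius_def)
  qed
  have "cm_type (supported_on T :: 'k fls set) (fls_X ^ m) = card (?A - ?B)"
    unfolding cm_type_def socle_mod_supported_on monomial_translate_supported_on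
    by (intro quotient_dim_supported_on sub) (simp add: diff finite_pseudo_frobenius)
  then show ?thesis unfolding diff by (simp add: card_image inj_on_def)
qed

text \<open>
  An exponent \<open>n > F\<close> of the conductor survives modulo \<open>x R\<close> if and only if \<open>n - m\<close> is a gap.
\<close>

lemma reduced_type_supported_on:
  "reduced_type (supported_on T :: 'k::field fls set) (fls_X ^ m) = card high_gaps"
proof -
  let ?B = "{n. n - int m \<in> T}"
  have diff: "{F<..} \<union> ?B - ?B = (\<lambda>g. g + int m) ` high_gaps"
  proof (intro equalityI subsetI)
    fix n assume "n \<in> {F<..} \<union> ?B - ?B"
    then have "n - int m \<in> high_gaps" by (auto simp: high_gaps_def)
    then show "n \<in> (\<lambda>g. g + int m) ` high_gaps" by (intro image_eqI) auto
  qed (auto simp: high_gaps_def)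
  have "finite high_gaps" using finite_subset high_gaps_subset finite_pseudo_frobenius by blast
  then have "reduced_type (supported_on T :: 'k fls set) (fls_X ^ m) = card ({F<..} \<union> ?B - ?B)"
    unfolding reduced_type_def conductor_supported_on monomial_translate_supported_on
      supported_on_plus
    by (intro quotient_dim_supported_on) (auto simp: diff)
  then show ?thesis unfolding diff by (simp add: card_image inj_on_def)
qed

lemma not_maximal_reduced_type:
  assumes f: "f \<in> pseudo_frobenius" "f \<le> F - int m"
  shows "\<not> maximal_reduced_type (supported_on T :: 'k::field fls set) (fls_X ^ m)"
proof -
  have "f \<notin> high_gaps" using f(2) by (simp add: high_gaps_def)
  then have "high_gaps \<subset> pseudo_frobenius" using high_gaps_subset f(1) by blast
  then have "card high_gaps < card pseudo_frobenius"
    by (intro psubset_card_mono finite_pseudo_frobenius)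
  then show ?thesis
    by (simp add: maximal_reduced_type_def reduced_type_supported_on cm_type_supported_on)
qed

lemma not_minimal_reduced_type:
  assumes g: "g \<notin> T" "F - int m < g" "g < F"
  shows "\<not> minimal_reduced_type (supported_on T :: 'k::field fls set) (fls_X ^ m)"
proof -
  have "{g, F} \<subseteq> high_gaps" using g frobenius_not_mem mult_pos by (auto simp: high_gaps_def)
  moreover have "finite high_gaps"
    using finite_subset high_gaps_subset finite_pseudo_frobenius by blast
  ultimately have "card {g, F} \<le> card high_gaps" by (intro card_mono)
  then show ?thesis using g by (simp add: minimal_reduced_type_def reduced_type_supported_on)
qed

end

lemma power_series_subring_supported_on:
  assumes "finite N" "0 \<notin> N"
  shows "power_series_subring N = (supported_on (int ` gen_semigroup N) :: 'k::comm_ring_1 fls set)"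
  unfolding power_series_subring_eq[OF assms]
proof (intro equalityI subsetI)
  fix z :: "'k fls" assume "z \<in> fps_to_fls ` {f. \<forall>n. fps_nth f n \<noteq> 0 \<longrightarrow> n \<in> gen_semigroup N}"
  then obtain f where f: "z = fps_to_fls f" "\<forall>n. fps_nth f n \<noteq> 0 \<longrightarrow> n \<in> gen_semigroup N" by blast
  show "z \<in> supported_on (int ` gen_semigroup N)"
  proof (rule supported_onI)
    fix n assume "z $$ n \<noteq> 0"
    then have "n \<ge> 0" "fps_nth f (nat n) \<noteq> 0" by (auto simp: f(1) split: if_splits)
    then show "n \<in> int ` gen_semigroup N" using f(2) by (intro image_eqI[of _ _ "nat n"]) auto
  qed
next
  fix z :: "'k fls" assume z: "z \<in> supported_on (int ` gen_semigroup N)"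
  have "fls_subdegree z \<ge> 0"
  proof (cases "z = 0")
    case False
    then have "fls_subdegree z \<in> int ` gen_semigroup N"
      by (intro supported_onD[OF z]) simp
    then show ?thesis by auto
  qed simp
  then have "z = fps_to_fls (fls_regpart z)" by simp
  moreover have "n \<in> gen_semigroup N" if "fps_nth (fls_regpart z) n \<noteq> 0" for n
    using supported_onD[OF z, of "int n"] that by auto
  ultimately show "z \<in> fps_to_fls ` {f. \<forall>n. fps_nth f n \<noteq> 0 \<longrightarrow> n \<in> gen_semigroup N}"
    by blast
qed

section \<open>Semigroups generated by a parallelogram\<close>

text \<open>
  In a sum of \<open>k\<close> generators, \<open>u\<close> and \<open>v\<close> count those that contain \<open>a\<close>, respectively \<open>b\<close>.  Since
  \<open>m + a + b\<close> is a generator, these two choices are independent of each other, and any \<open>u, v \<le> k\<close>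
  occur.
\<close>

lemma gen_semigroup_parallelogram:
  "n \<in> gen_semigroup {m, m + a, m + b, m + a + b} \<longleftrightarrow>
     (\<exists>k u v. u \<le> k \<and> v \<le> k \<and> n = k * m + u * a + v * b)"
  (is "n \<in> gen_semigroup ?N \<longleftrightarrow> ?P n")
proof
  assume "n \<in> gen_semigroup ?N"
  then show "?P n"
  proof induction
    case zero
    show ?case by (intro exI[of _ 0]) simp
  next
    case (gen n)
    then consider "n = m" | "n = m + a" | "n = m + b" | "n = m + a + b" by blast
    then show ?case
    proof cases
      case 1
      then show ?thesis by - (rule exI[of _ 1], rule exI[of _ 0], rule exI[of _ 0], simp)
    next
      case 2
      then show ?thesis by - (rule exI[of _ 1], rule exI[of _ 1], rule exI[of _ 0], simp)
    next
      case 3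
      then show ?thesis by - (rule exI[of _ 1], rule exI[of _ 0], rule exI[of _ 1], simp)
    next
      case 4
      then show ?thesis by - (rule exI[of _ 1], rule exI[of _ 1], rule exI[of _ 1], simp)
    qed
  next
    case (add n n')
    then obtain k u v k' u' v' where "u \<le> k" "v \<le> k" "n = k * m + u * a + v * b"
      "u' \<le> k'" "v' \<le> k'" "n' = k' * m + u' * a + v' * b" by blast
    then show ?case
      by (intro exI[of _ "k + k'"] exI[of _ "u + u'"] exI[of _ "v + v'"])
        (simp add: algebra_simps)
  qed
next
  assume "?P n"
  then obtain k u v where uv: "u \<le> k" "v \<le> k" and n: "n = k * m + u * a + v * b" by blast
  have mult: "c * g \<in> gen_semigroup ?N" if "g \<in> ?N" for c g
    by (induction c) (simp_all only: mult_0 mult_Suc gen_semigroup.zero gen_semigroup.add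
        gen_semigroup.gen that)
  \<comment> \<open>take \<open>m + a + b\<close> as often as possible, namely \<open>min u v\<close> times\<close>
  show "n \<in> gen_semigroup ?N"
  proof (cases "u \<le> v")
    case True
    then obtain i where i: "v = u + i" using le_Suc_ex by blast
    obtain j where "k = v + j" using uv(2) le_Suc_ex by blast
    then have "n = u * (m + a + b) + i * (m + b) + j * m" by (simp add: n i algebra_simps)
    then show ?thesis by (simp only:) (intro gen_semigroup.add mult; simp)
  next
    case False
    then obtain i where i: "u = v + i" using le_Suc_ex nat_le_linear by blast
    obtain j where "k = u + j" using uv(1) le_Suc_ex by blast
    then have "n = v * (m + a + b) + i * (m + a) + j * m" by (simp add: n i algebra_simps)
    then show ?thesis by (simp only:) (intro gen_semigroup.add mult; simp)
  qed
qed

text \<open>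
  This reduces the condition on a pseudo-Frobenius number to the generators.
\<close>

lemma add_gen_semigroup_mem:
  assumes gens: "\<And>n. n \<in> N \<Longrightarrow> f + int n \<in> int ` gen_semigroup N"
    and s: "s \<in> gen_semigroup N" "s \<noteq> 0"
  shows "f + int s \<in> int ` gen_semigroup N"
proof -
  from s(1) have "s = 0 \<or> f + int s \<in> int ` gen_semigroup N"
  proof induction
    case (add a b)
    show ?case
    proof (cases "a = 0")
      case False
      with add.IH obtain c where "c \<in> gen_semigroup N" "f + int a = int c" by blast
      then show ?thesis
        using gen_semigroup.add[OF _ add.hyps(2)] by (intro disjI2 image_eqI[of _ _ "c + b"]) auto
    qed (use add.IH in simp)
  qed (use gens in auto)
  with s(2) show ?thesis by simp
qed

section \<open>Canonical forms with respect to \<open>q (q - 1)\<close>, \<open>q - 1\<close> and \<open>2 q\<close>\<close>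

text \<open>
  Modulo \<open>q\<close> the number is congruent to \<open>- u\<close>, which determines \<open>u\<close>; then \<open>n - u (q - 1)\<close> is
  \<open>q\<close> times some \<open>c\<close>, and \<open>v\<close> is determined by \<open>2 v = c\<close> modulo \<open>q - 1\<close>.  There the inverse of \<open>2\<close> is \<open>h\<close>,
  because \<open>2 h = q\<close> is congruent to \<open>1\<close>.
\<close>

lemma canonical_form_exists:
  fixes q h n :: int
  assumes q: "q = 2 * h" "q \<ge> 2"
  shows "\<exists>k u v. 0 \<le> u \<and> u < q \<and> 0 \<le> v \<and> v < q - 1 \<and>
    n = k * (q * (q - 1)) + u * (q - 1) + v * (2 * q)"
proof -
  define u where "u = (- n) mod q"
  define d0 where "d0 = (- n) div q"
  have n: "- n = q * d0 + u" by (simp add: u_def d0_def)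
  define c where "c = - d0 - u"
  define v where "v = (h * c) mod (q - 1)"
  define d where "d = (h * c) div (q - 1)"
  have hc: "h * c = (q - 1) * d + v" by (simp add: v_def d_def)
  have "n = u * (q - 1) + q * c" using n unfolding c_def by (simp add: algebra_simps)
  also have "c = 2 * (h * c) - (q - 1) * c" by (simp add: q(1) algebra_simps)
  also have "\<dots> = 2 * v + (q - 1) * (2 * d - c)" unfolding hc by (simp add: algebra_simps)
  finally have "n = (2 * d - c) * (q * (q - 1)) + u * (q - 1) + v * (2 * q)"
    by (simp add: algebra_simps)
  moreover have "0 \<le> u" "u < q" "0 \<le> v" "v < q - 1" using q by (simp_all add: u_def v_def)
  ultimately show ?thesis by blast
qed

text \<open>
  Reduction modulo \<open>q\<close> gives \<open>u' = u + q i\<close> and reduction modulo \<open>q - 1\<close>, where \<open>2\<close> is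
  invertible, gives \<open>v' = v + (q - 1) j\<close>.  The bounds force \<open>i, j \<ge> 0\<close>, and comparing the two
  sides yields \<open>k = k' + i + 2 j\<close>.
\<close>

lemma canonical_form_minimal:
  fixes q h :: int
  assumes q: "q = 2 * h" "q \<ge> 2"
    and uv: "u < q" "v < q - 1" "0 \<le> u'" "0 \<le> v'"
    and eq: "k * (q * (q - 1)) + u * (q - 1) + v * (2 * q)
      = k' * (q * (q - 1)) + u' * (q - 1) + v' * (2 * q)"
  shows "u \<le> u'" "v \<le> v'" "k' \<le> k"
proof -
  \<comment> \<open>the quotients of \<open>u' - u\<close> by \<open>q\<close> and, below, of \<open>v' - v\<close> by \<open>q - 1\<close>, read off from \<open>eq\<close>\<close>
  define i where "i = (k' - k) * (q - 1) + (u' - u) + 2 * (v' - v)"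
  have i: "u' = u + q * i" using eq unfolding i_def by (simp add: algebra_simps)
  have "q * (i + 1) > 0" using i uv by (simp add: algebra_simps)
  then have i0: "i \<ge> 0" using q by (simp add: zero_less_mult_iff)
  have "q * ((k - k' - i) * (q - 1)) = q * (2 * (v' - v))"
    using eq unfolding i by (simp add: algebra_simps)
  then have two: "(k - k' - i) * (q - 1) = 2 * (v' - v)" using q by simp
  define j where "j = h * (k - k' - i) - (v' - v)"
  have "h * ((k - k' - i) * (q - 1)) = q * (v' - v)" unfolding two by (simp add: q)
  then have j: "v' = v + (q - 1) * j" unfolding j_def by (simp add: algebra_simps)
  have "(q - 1) * (j + 1) > 0" using j uv by (simp add: algebra_simps)
  then have j0: "j \<ge> 0" using q by (simp add: zero_less_mult_iff)
  have "(q - 1) * (k - k' - i) = (q - 1) * (2 * j)" using two unfolding j by (simp add: algebra_simps)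
  then have "k - k' - i = 2 * j" using q by simp
  then show "k' \<le> k" using i0 j0 by simp
  show "u \<le> u'" "v \<le> v'" using i j i0 j0 q by simp_all
qed

theorem proposition3p10:
  fixes h n1 n2 n3 n4 :: nat
    and S :: "nat set"
    and R :: "'k::{alg_closed_field, field_char_0} fls set"
    and x :: "'k fls"
  assumes "h \<ge> 2"
    and "n1 = 2 * h * (2 * h + 1)"
    and "n2 = (2 * h - 1) * (2 * h + 1)"
    and "n3 = 2 * h * (2 * h + 1) + (2 * h - 1)"
    and "n4 = (2 * h - 1) * (2 * h)"
    and "S = gen_semigroup {n1, n2, n3, n4}"
    and "R = power_series_subring {n1, n2, n3, n4}"
    and "x = fls_X ^ multiplicity_of S"
  shows "\<not> maximal_reduced_type R x \<and> \<not> minimal_reduced_type R x"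
proof -
  define q where "q = int (2 * h)"
  define M where "M = q * (q - 1)"
  define T where "T = int ` S"
  have q: "q = 2 * int h" "q \<ge> 4" using assms(1) by (simp_all add: q_def)
  have h1: "int (2 * h - 1) = q - 1" using assms(1) by (simp add: q_def)
  have "int n4 = int (2 * h - 1) * q" unfolding assms(5) q_def by (rule of_nat_mult)
  then have n4: "int n4 = M" unfolding h1 by (simp add: M_def)
  have M_pos: "M > 0" using q by (simp add: M_def)
  have N: "{n1, n2, n3, n4} = {n4, n4 + (2*h - 1), n4 + 4*h, n4 + (2*h - 1) + 4*h}"
  proof -
    obtain j where "h = Suc j" using assms(1) by (cases h) auto
    then have "n1 = n4 + 4*h" "n2 = n4 + (2*h - 1)" "n3 = n4 + (2*h - 1) + 4*h"
      unfolding assms(2-5) by (simp_all add: algebra_simps)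
    then show ?thesis by auto
  qed
  have mem_T: "n \<in> T \<longleftrightarrow>
      (\<exists>k u v. 0 \<le> u \<and> u \<le> k \<and> 0 \<le> v \<and> v \<le> k \<and> n = k * M + u * (q - 1) + v * (2 * q))" for n
  proof
    assume "n \<in> T"
    then obtain s where s: "n = int s" "s \<in> S" by (auto simp: T_def)
    then obtain k u v where uv: "u \<le> k" "v \<le> k" and "s = k * n4 + u * (2*h - 1) + v * (4*h)"
      unfolding assms(6) N gen_semigroup_parallelogram by blast
    then have "n = int k * M + int u * (q - 1) + int v * (2 * q)"
      by (simp only: s(1) of_nat_add of_nat_mult h1 n4) (simp add: q_def)
    with uv show "\<exists>k u v. 0 \<le> u \<and> u \<le> k \<and> 0 \<le> v \<and> v \<le> k \<and>
        n = k * M + u * (q - 1) + v * (2 * q)"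
      by (intro exI[of _ "int k"] exI[of _ "int u"] exI[of _ "int v"]) simp
  next
    assume "\<exists>k u v. 0 \<le> u \<and> u \<le> k \<and> 0 \<le> v \<and> v \<le> k \<and>
        n = k * M + u * (q - 1) + v * (2 * q)"
    then obtain k u v where uv: "0 \<le> u" "u \<le> k" "0 \<le> v" "v \<le> k"
      and n: "n = k * M + u * (q - 1) + v * (2 * q)" by blast
    have "n = int (nat k * n4 + nat u * (2*h - 1) + nat v * (4*h))"
      using uv by (simp only: n of_nat_add of_nat_mult h1 n4) (simp add: q_def)
    moreover have "nat k * n4 + nat u * (2*h - 1) + nat v * (4*h) \<in> S"
      unfolding assms(6) N gen_semigroup_parallelogram using uv nat_mono by blast
    ultimately show "n \<in> T" unfolding T_def by blast
  qed
  have canonical_mem: "k * M + u * (q - 1) + v * (2 * q) \<in> T \<longleftrightarrow> u \<le> k \<and> v \<le> k"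
    if "0 \<le> u" "u < q" "0 \<le> v" "v < q - 1" for k u v
  proof
    assume "k * M + u * (q - 1) + v * (2 * q) \<in> T"
    then obtain k' u' v' where "0 \<le> u'" "u' \<le> k'" "0 \<le> v'" "v' \<le> k'"
      "k * M + u * (q - 1) + v * (2 * q) = k' * M + u' * (q - 1) + v' * (2 * q)"
      unfolding mem_T by blast
    then show "u \<le> k \<and> v \<le> k"
      using canonical_form_minimal[OF q(1), of u v u' v' k k'] that q(2) unfolding M_def by linarith
  qed (use that mem_T in blast)
  \<comment> \<open>the gaps with canonical form \<open>(k, u, v) = (q - 2, q - 1, v)\<close>; the largest one is \<open>F\<close>\<close>
  define pt where "pt v = (q - 2) * M + (q - 1) * (q - 1) + v * (2 * q)" for v
  have pt_gap: "pt v \<notin> T" if "0 \<le> v" "v < q - 1" for v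
    unfolding pt_def using canonical_mem[of "q - 1" v "q - 2"] that q by simp
  define F where "F = pt (q - 2)"
  have above: "n \<in> T" if n: "n > F" for n
  proof -
    obtain k u v where uv: "0 \<le> u" "u < q" "0 \<le> v" "v < q - 1"
      and n_eq: "n = k * M + u * (q - 1) + v * (2 * q)"
      using canonical_form_exists[OF q(1), of n] q(2) unfolding M_def by auto
    have "u * (q - 1) \<le> (q - 1) * (q - 1)" "v * (2 * q) \<le> (q - 2) * (2 * q)"
      using uv q by (intro mult_right_mono; simp)+
    then have "(q - 2) * M < k * M" using n unfolding F_def pt_def n_eq by linarith
    then have "q - 2 < k" using M_pos by (simp add: mult_less_cancel_right)
    then show ?thesis using uv canonical_mem n_eq by simp
  qed
  have T_le: "M \<le> n" if nT: "n \<in> T" and n0: "n \<noteq> 0" for n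
  proof -
    obtain k u v where uv: "0 \<le> u" "u \<le> k" "0 \<le> v" "v \<le> k"
      and n: "n = k * M + u * (q - 1) + v * (2 * q)" using nT unfolding mem_T by blast
    have "k \<noteq> 0" using uv n n0 by auto
    with uv have "1 \<le> k" by simp
    then have "1 * M \<le> k * M" using M_pos by (intro mult_right_mono) simp_all
    moreover have "0 \<le> u * (q - 1)" "0 \<le> v * (2 * q)" using uv q by simp_all
    ultimately show ?thesis using n by linarith
  qed
  have "multiplicity_of S = n4"
    unfolding multiplicity_of_def
  proof (rule Least_equality)
    show "n4 \<in> S \<and> n4 \<noteq> 0"
      using n4 M_pos by (auto simp: assms(6) intro: gen_semigroup.gen)
    fix n assume "n \<in> S \<and> n \<noteq> 0"
    then have "M \<le> int n" by (intro T_le) (auto simp: T_def)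
    then show "n4 \<le> n" using n4 by simp
  qed
  then have x: "x = fls_X ^ n4" using assms(8) by simp
  have N_pos: "0 \<notin> {n1, n2, n3, n4}"
    unfolding N using n4 M_pos by auto
  have R: "R = supported_on T"
    using power_series_subring_supported_on[OF _ N_pos] by (simp add: assms(7) T_def assms(6))
  interpret semigroup_exponents T F n4
  proof
    show "0 \<in> T" by (auto simp: T_def assms(6) intro: gen_semigroup.zero)
    show "a + b \<in> T" if "a \<in> T" "b \<in> T" for a b
      using that by (auto simp: T_def assms(6) simp flip: of_nat_add intro: gen_semigroup.add)
    show "a \<ge> 0" if "a \<in> T" for a using that by (auto simp: T_def)
    show "F \<notin> T" unfolding F_def using q by (intro pt_gap) auto
    show "n \<in> T" if "n > F" for n using that by (rule above)
    show "int n4 \<in> T" by (auto simp: T_def assms(6) intro: gen_semigroup.gen)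
    show "n4 > 0" using n4 M_pos by linarith
    show "int n4 \<le> a" if "a \<in> T" "a \<noteq> 0" for a using T_le[OF that] n4 by simp
  qed
  have "pt 0 \<in> pseudo_frobenius"
    unfolding pseudo_frobenius_def
  proof (intro CollectI conjI ballI)
    show "pt 0 \<notin> T" using q by (intro pt_gap) auto
    fix s assume s: "s \<in> T - {0}"
    have gens: "pt 0 + int n \<in> T" if "n \<in> {n1, n2, n3, n4}" for n
    proof -
      from that consider "n = n4" | "n = n4 + (2*h - 1)" | "n = n4 + 4*h"
        | "n = n4 + (2*h - 1) + 4*h" unfolding N by blast
      then show ?thesis
      proof cases
        case 1
        have "pt 0 + int n = (q - 1) * M + (q - 1) * (q - 1) + 0 * (2 * q)"
          by (simp add: 1 n4 pt_def algebra_simps)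
        then show ?thesis using canonical_mem[of "q - 1" 0 "q - 1"] q by simp
      next
        case 2
        \<comment> \<open>\<open>u\<close> grows from \<open>q - 1\<close> to \<open>q\<close>; as \<open>q (q - 1) = M\<close>, it turns into \<open>0\<close> and \<open>k\<close> gains one\<close>
        have "int n = M + (q - 1)" by (simp only: 2 of_nat_add n4 h1)
        then have "pt 0 + int n = q * M + 0 * (q - 1) + 0 * (2 * q)"
          by (simp add: pt_def M_def algebra_simps)
        then show ?thesis using canonical_mem[of 0 0 q] q by simp
      next
        case 3
        have "int n = M + 2 * q" by (simp add: 3 n4 q_def)
        then have "pt 0 + int n = (q - 1) * M + (q - 1) * (q - 1) + 1 * (2 * q)"
          by (simp add: pt_def algebra_simps)
        then show ?thesis using canonical_mem[of "q - 1" 1 "q - 1"] q by simp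
      next
        case 4
        have "int n = M + (q - 1) + 2 * q" by (simp only: 4 of_nat_add n4 h1) (simp add: q_def)
        then have "pt 0 + int n = q * M + 0 * (q - 1) + 1 * (2 * q)"
          by (simp add: pt_def M_def algebra_simps)
        then show ?thesis using canonical_mem[of 0 1 q] q by simp
      qed
    qed
    from s obtain s' where "s = int s'" "s' \<in> S" "s' \<noteq> 0" by (auto simp: T_def)
    then show "pt 0 + s \<in> T"
      using add_gen_semigroup_mem[of "{n1, n2, n3, n4}" "pt 0" s'] gens
      unfolding T_def assms(6) by blast
  qed
  moreover have "pt 0 \<le> F - int n4"
  proof -
    have "q * (q - 1) \<le> q * (2 * (q - 2))" using q by (intro mult_left_mono) auto
    then show ?thesis by (simp add: F_def pt_def n4 M_def algebra_simps)
  qed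
  ultimately have "\<not> maximal_reduced_type R x"
    unfolding R x by (rule not_maximal_reduced_type)
  moreover have "\<not> minimal_reduced_type R x"
    unfolding R x
  proof (rule not_minimal_reduced_type)
    show "pt (q - 3) \<notin> T" using q by (intro pt_gap) auto
    have "q * 2 < q * (q - 1)" using q by (intro mult_strict_left_mono) auto
    then show "F - int n4 < pt (q - 3)" by (simp add: F_def pt_def n4 M_def algebra_simps)
    show "pt (q - 3) < F" using q by (simp add: F_def pt_def)
  qed
  ultimately show ?thesis by blast
qed

end
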